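(* Real or complex polynomial Riccati differential equations $a(x)\dot y=b_0(x)+b_1(x)y+b_2(x)y^2$ of degree $\eta$ with $b_2(x)\not\equiv 0$ have at most $\eta+1$ polynomial solutions when $\eta\ge 1$, and at most $2$ polynomial solutions when $\eta=0$. Moreover, there are (real or complex) equations of this type having any given number of polynomial solutions smaller than or equal to these upper bounds.
   Context: Let $\mathbb{F}=\mathbb{R}$ or $\mathbb{C}$. A polynomial Riccati differential equation of degree $\eta$ is an equation $a(x)\dot y=b_0(x)+b_1(x)y+b_2(x)y^2$ with $a,b_0,b_1,b_2\in\mathbb{F}[x]$ and $\eta=\max\{\deg a,\deg b_0,\deg b_1,\deg b_2\}$; the dot denotes $d/dx$. It is called real if $\mathbb{F}=\mathbb{R}$ and complex if $\mathbb{F}=\mathbb{C}$. A polynomial solution is a polynomial $y\in\mathbb{F}[x]$ satisfying the equation identically.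
   Formalization: For complex equations of degree η=0 the number 0 of polynomial solutions is excluded from the existence claim, since a constant root of b_0+b_1y+b_2y^2 is always a solution; for real equations every number up to the bound is attained. *)

theory Defs
  imports
    Complex_Main
    "HOL-Computational_Algebra.Polynomial"
    "HOL-Computational_Algebra.Fundamental_Theorem_Algebra"
begin

definition riccati_degree :: "'a::field poly \<Rightarrow> 'a poly \<Rightarrow> 'a poly \<Rightarrow> 'a poly \<Rightarrow> nat" where
  "riccati_degree a b0 b1 b2 = Max {degree a, degree b0, degree b1, degree b2}"

definition riccati_poly_solutions ::
    "'a::field poly \<Rightarrow> 'a poly \<Rightarrow> 'a poly \<Rightarrow> 'a poly \<Rightarrow> 'a poly set" where
  "riccati_poly_solutions a b0 b1 b2 = {y. a * pderiv y = b0 + b1 * y + b2 * y ^ 2}"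

definition riccati_bound :: "nat \<Rightarrow> nat" where
  "riccati_bound \<eta> = (if \<eta> = 0 then 2 else \<eta> + 1)"

text \<open>
  A complex equation of degree 0 always has a polynomial solution, namely a constant root of the
  quadratic right-hand side. Hence no complex equation of degree 0 has exactly 0 solutions, whereas
  the real equation \<open>y' = 1 + y\<^sup>2\<close> does.
\<close>

lemma complex_riccati_degree_0_solvable:
  fixes a b0 b1 b2 :: "complex poly"
  assumes "b2 \<noteq> 0" and "riccati_degree a b0 b1 b2 = 0"
  shows "riccati_poly_solutions a b0 b1 b2 \<noteq> {}"
proof -
  have "degree b0 = 0" "degree b1 = 0" "degree b2 = 0"
    using assms(2) by (auto simp: riccati_degree_def)
  then obtain c0 c1 c2 where c: "b0 = [:c0:]" "b1 = [:c1:]" "b2 = [:c2:]"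
    by (metis degree_eq_zeroE)
  with assms(1) have "degree [:c0, c1, c2:] \<noteq> 0" by auto
  then obtain z where "poly [:c0, c1, c2:] z = 0"
    using fundamental_theorem_of_algebra constant_degree by metis
  then have "[:z:] \<in> riccati_poly_solutions a b0 b1 b2"
    by (simp add: riccati_poly_solutions_def c power2_eq_square pderiv_pCons algebra_simps)
  then show ?thesis by blast
qed

end

theory Submission
  imports Defs "HOL-Computational_Algebra.Field_as_Ring" "HOL-Computational_Algebra.Polynomial_Factorial"
begin

text \<open>
  After a translation by one solution, the reciprocals of the other solutions solve a linear
  equation of order one, so they form part of a pencil \<open>(q + c r) / h\<close> with constants \<open>c\<close> and
  coprime polynomials \<open>q\<close>, \<open>r\<close>. A member of the pencil yields a polynomial only if \<open>q + c r\<close>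
  divides \<open>h\<close>. These divisors are pairwise coprime, hence their product divides \<open>h\<close>. On the other hand
  the equation gives \<open>b\<^sub>2 h r = a (r' q - r q')\<close>, and comparing degrees bounds the number of constants
  by \<open>deg a\<close>. For \<open>h = (x - r\<^sub>1) \<dots> (x - r\<^sub>n)\<close> the equation \<open>h y' = h' y - y\<^sup>2\<close> has the \<open>n + 1\<close>
  solutions \<open>0\<close> and \<open>h / (x - r\<^sub>i)\<close>.
\<close>

section \<open>Wronskians, coprime divisors and pencils of polynomials\<close>

lemma wronskian_eq_0_imp_proportional:
  fixes p q :: "'a::{field_char_0,field_gcd} poly"
  assumes "q \<noteq> 0" and "pderiv p * q = p * pderiv q"
  obtains c where "p = smult c q"
proof -
  have "gcd p q \<noteq> 0" using assms by simp
  then obtain g m n where g: "g \<noteq> 0" "p = n * g" "q = m * g" "coprime n m"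
    by (metis gcd_coprime_exists)
  have "g^2 * (pderiv n * m) = g^2 * (n * pderiv m)"
    using assms(2) by (simp add: g pderiv_mult algebra_simps power2_eq_square)
  then have eq: "pderiv n * m = n * pderiv m" using g(1) by simp
  \<comment> \<open>By coprimality each of \<open>n\<close> and \<open>m\<close> divides its own
    derivative, which in characteristic 0 forces it to be constant.\<close>
  then have "m dvd pderiv m" using g(4)
    by (metis coprime_commute coprime_dvd_mult_right_iff dvd_triv_right)
  moreover have "n dvd pderiv n" using g(4) eq
    by (metis coprime_dvd_mult_left_iff dvd_triv_left)
  ultimately obtain \<alpha> \<beta> where "n = [:\<alpha>:]" "m = [:\<beta>:]"
    by (metis dvd_pderiv_iff degree_eq_zeroE)
  then have "p = smult (\<alpha> / \<beta>) q" using assms(1) g by auto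
  then show thesis by (rule that)
qed

lemma prod_pairwise_coprime_dvd:
  fixes f :: "'b \<Rightarrow> 'a::semiring_gcd"
  assumes "finite A" "\<And>x. x \<in> A \<Longrightarrow> f x dvd h"
    and "\<And>x y. x \<in> A \<Longrightarrow> y \<in> A \<Longrightarrow> x \<noteq> y \<Longrightarrow> coprime (f x) (f y)"
  shows "prod f A dvd h"
  using assms
proof (induction A rule: finite_induct)
  case (insert x A)
  have "coprime (f x) (prod f A)" by (rule prod_coprime_right) (use insert in auto)
  then show ?case using insert by (auto intro!: divides_mult)
qed auto

text \<open>A common divisor of two members divides their difference, a nonzero multiple of
  \<open>r\<close>, and hence also \<open>q\<close>.\<close>

lemma coprime_pencil:
  fixes q r :: "'a::field_gcd poly"
  assumes "coprime q r" "c \<noteq> d"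
  shows "coprime (q + smult c r) (q + smult d r)"
proof (rule coprimeI)
  fix p assume p: "p dvd q + smult c r" "p dvd q + smult d r"
  have "p dvd (q + smult c r) - (q + smult d r)" using p by (rule dvd_diff)
  then have "p dvd smult (c - d) r" by (simp add: smult_diff_left)
  then have r: "p dvd r" using assms(2) by (simp add: dvd_smult_iff)
  then have "p dvd smult c r" by (rule dvd_smult)
  then have "p dvd q" using p(1) by (metis dvd_add_left_iff)
  with r show "is_unit p" using assms(1) by (meson not_coprimeI)
qed

text \<open>Each of the two products loses a degree to the derivative. The strict inequality is what
  later turns the degree count into the exact bound.\<close>

lemma degree_wronskian_less:
  fixes p q :: "'a::field_char_0 poly"
  assumes "pderiv p * q - p * pderiv q \<noteq> 0"
  shows "degree (pderiv p * q - p * pderiv q) < degree p + degree q"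
proof -
  \<comment> \<open>A vanishing product has degree 0, so in the cases with a constant factor
    strictness needs the other factor to be nonconstant.\<close>
  have pos: "degree p > 0 \<or> degree q > 0"
    using assms by (metis pderiv_eq_0_iff not_gr_zero mult_zero_left mult_zero_right diff_0_right)
  have "degree (pderiv p * q) < degree p + degree q"
  proof (cases "degree p = 0")
    case True
    then have "pderiv p = 0" by (simp add: pderiv_eq_0_iff)
    then show ?thesis using pos by simp
  next
    case False
    then show ?thesis using degree_mult_le[of "pderiv p" q] by (simp add: degree_pderiv)
  qed
  moreover have "degree (p * pderiv q) < degree p + degree q"
  proof (cases "degree q = 0")
    case True
    then have "pderiv q = 0" by (simp add: pderiv_eq_0_iff)
    then show ?thesis using pos by simp
  next
    case False
    then show ?thesis using degree_mult_le[of p "pderiv q"] by (simp add: degree_pderiv)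
  qed
  ultimately show ?thesis by (rule degree_diff_less)
qed

section \<open>Upper bound for the number of solutions\<close>

text \<open>For nonzero \<open>z1\<close>, division by \<open>z * z1 * z2\<close> turns the
  conclusion into 1/z - 1/z1 = c (1/z2 - 1/z1): the reciprocals lie on an affine line. The cleared
  form stays inside the polynomial ring.\<close>

lemma bernoulli_reciprocal_pencil:
  fixes a B b2 z z1 z2 :: "'a::{field_char_0,field_gcd} poly"
  assumes "a \<noteq> 0" "z \<noteq> 0" "z1 \<noteq> z2" "z2 \<noteq> 0"
    and z: "a * pderiv z = z * (B + b2 * z)"
    and z1: "a * pderiv z1 = z1 * (B + b2 * z1)"
    and z2: "a * pderiv z2 = z2 * (B + b2 * z2)"
  obtains c where "(z1 - z) * z2 = smult c ((z1 - z2) * z)"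
proof -
  define n m where nm: "n = (z1 - z) * z2" "m = (z1 - z2) * z"
  \<comment> \<open>This expression is symmetric in the three solutions, so \<open>n\<close> and
    \<open>m\<close> satisfy the same linear homogeneous equation. Their Wronskian therefore
    vanishes.\<close>
  let ?k = "2 * B + b2 * (z + z1 + z2)"
  have "a * pderiv n = (a * pderiv z1 - a * pderiv z) * z2 + (z1 - z) * (a * pderiv z2)"
    by (simp add: nm pderiv_mult pderiv_diff algebra_simps)
  also have "\<dots> = n * ?k" unfolding z z1 z2 nm by (simp add: algebra_simps)
  finally have n: "a * pderiv n = n * ?k" .
  have "a * pderiv m = (a * pderiv z1 - a * pderiv z2) * z + (z1 - z2) * (a * pderiv z)"
    by (simp add: nm pderiv_mult pderiv_diff algebra_simps)
  also have "\<dots> = m * ?k" unfolding z z1 z2 nm by (simp add: algebra_simps)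
  finally have m: "a * pderiv m = m * ?k" .
  have "a * (pderiv n * m) = (a * pderiv n) * m" by (simp add: ac_simps)
  also have "\<dots> = n * (a * pderiv m)" unfolding n m by (simp add: ac_simps)
  finally have "a * (pderiv n * m) = a * (n * pderiv m)" by (simp add: ac_simps)
  then have "pderiv n * m = n * pderiv m" using assms(1) by simp
  moreover have "m \<noteq> 0" using assms by (simp add: nm)
  ultimately show thesis using that unfolding nm by (metis wronskian_eq_0_imp_proportional)
qed

lemma bernoulli_solutions_card_le:
  fixes a B b2 :: "'a::{field_char_0,field_gcd} poly"
  assumes "finite Z" "card Z \<ge> 2" "b2 \<noteq> 0" "0 \<notin> Z"
    and sol: "\<And>z. z \<in> Z \<Longrightarrow> a * pderiv z = z * (B + b2 * z)"
  shows "card Z \<le> degree a"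
proof -
  obtain z1 z2 where z12: "z1 \<in> Z" "z2 \<in> Z" "z1 \<noteq> z2"
    using assms(2) by (metis card_le_Suc0_iff_eq assms(1) not_less_eq_eq numeral_2_eq_2)
  have z12_nz: "z1 \<noteq> 0" "z2 \<noteq> 0" using z12 assms(4) by auto
  have "gcd z1 z2 \<noteq> 0" using z12_nz by simp
  then obtain g p q where g: "g \<noteq> 0" "z1 = p * g" "z2 = q * g" "coprime p q"
    by (metis gcd_coprime_exists)
  \<comment> \<open>With 1/z1 = q/h and 1/z2 = p/h, the affine line of reciprocals is (q + c r)/h;
    \<open>c\<close> = 0 gives \<open>z1\<close> and \<open>c\<close> = 1 gives
    \<open>z2\<close>.\<close>
  define r where "r = p - q"
  define h where "h = g * p * q"
  have r_nz: "r \<noteq> 0" using z12(3) g by (auto simp: r_def)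
  have h_nz: "h \<noteq> 0" using z12_nz g by (auto simp: h_def)
  have "coprime q r"
  proof (rule coprimeI)
    fix d assume "d dvd q" "d dvd r"
    then have "d dvd p" unfolding r_def by (metis dvd_add_right_iff diff_add_cancel)
    with \<open>d dvd q\<close> show "is_unit d" using g(4) by (meson not_coprimeI)
  qed
  define W where "W = pderiv r * q - r * pderiv q"
  \<comment> \<open>Eliminating \<open>B\<close> from the equations of \<open>z1\<close> and
    \<open>z2\<close> leaves their Wronskian. Cancelling the square of \<open>g\<close> then relates
    \<open>a\<close>, \<open>W\<close>, \<open>b2\<close>, \<open>h\<close> and
    \<open>r\<close>.\<close>
  have "a * pderiv z1 * z2 - z1 * (a * pderiv z2) = z1 * z2 * (b2 * (z1 - z2))"
    unfolding sol[OF z12(1)] sol[OF z12(2)] by (simp add: algebra_simps)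
  moreover have "a * pderiv z1 * z2 - z1 * (a * pderiv z2) = g^2 * (a * W)"
    by (simp add: g W_def r_def pderiv_mult pderiv_diff algebra_simps power2_eq_square)
  moreover have "z1 * z2 * (b2 * (z1 - z2)) = g^2 * (b2 * h * r)"
    by (simp add: g h_def r_def algebra_simps power2_eq_square)
  ultimately have aW: "a * W = b2 * h * r" using g(1) by simp
  \<comment> \<open>The right-hand side is nonzero, so two distinct nonzero solutions already force
    \<open>a\<close> to be nonzero.\<close>
  then have a_nz: "a \<noteq> 0" and W_nz: "W \<noteq> 0" using assms(3) h_nz r_nz by auto
  define P where "P = (\<lambda>c. q + smult c r)"
  have "\<exists>c. z * P c = h" if z: "z \<in> Z" for z
  proof -
    have "z \<noteq> 0" using z assms(4) by auto
    obtain c where "(z1 - z) * z2 = smult c ((z1 - z2) * z)"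
      using bernoulli_reciprocal_pencil[OF a_nz \<open>z \<noteq> 0\<close> z12(3) z12_nz(2) sol[OF z]
          sol[OF z12(1)] sol[OF z12(2)]] by blast
    then have "g * (z * P c) = g * h"
      by (simp add: g P_def r_def h_def algebra_simps smult_diff_right)
    then show ?thesis using g(1) by auto
  qed
  then obtain c where c: "\<And>z. z \<in> Z \<Longrightarrow> z * P (c z) = h" by metis
  have inj: "inj_on c Z"
  proof
    fix y z assume yz: "y \<in> Z" "z \<in> Z" "c y = c z"
    then have "y * P (c y) = z * P (c y)" "P (c y) \<noteq> 0" using c[of y] c[of z] h_nz by auto
    then show "y = z" by simp
  qed
  define C where "C = c ` Z"
  have C: "finite C" "card C = card Z" using inj assms(1) by (auto simp: C_def card_image)
  have P_dvd: "P x dvd h" if "x \<in> C" for x using that c by (auto simp: C_def) (metis dvd_triv_right)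
  have P_nz: "P x \<noteq> 0" if "x \<in> C" for x using P_dvd[OF that] h_nz by auto
  have "prod P C dvd h"
    by (rule prod_pairwise_coprime_dvd)
      (use C P_dvd coprime_pencil[OF \<open>coprime q r\<close>] in \<open>auto simp: P_def\<close>)
  then have "degree (prod P C) \<le> degree h" using h_nz by (rule dvd_imp_degree_le)
  moreover have "degree (prod P C) = (\<Sum>x\<in>C. degree (P x))"
    by (rule degree_prod_sum_eq) (use P_nz in auto)
  moreover have "degree a + degree W = degree b2 + degree h + degree r"
    using aW a_nz W_nz h_nz r_nz assms(3) by (metis degree_mult_eq mult_eq_0_iff)
  ultimately have deg: "(\<Sum>x\<in>C. degree (P x)) + degree r \<le> degree a + degree W" by linarith
  \<comment> \<open>Two constant members would make \<open>r\<close> and \<open>q\<close> constant,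
    and \<open>W\<close> would vanish.\<close>
  have unique: "x = y" if "degree (P x) = 0" "degree (P y) = 0" for x y
  proof (rule ccontr)
    assume "x \<noteq> y"
    have "P x - P y = smult (x - y) r" by (simp add: P_def smult_diff_left)
    moreover have "degree (P x - P y) = 0" using that degree_diff_le_max[of "P x" "P y"] by simp
    ultimately have r0: "degree r = 0" using \<open>x \<noteq> y\<close> by simp
    have "degree (P x - smult x r) \<le> 0" by (rule degree_diff_le) (use that r0 in auto)
    then have "degree q = 0" by (simp add: P_def)
    with r0 have "W = 0" by (simp add: W_def flip: pderiv_eq_0_iff)
    with W_nz show False by simp
  qed
  \<comment> \<open>\<open>x0\<close> is the constant member if there is one, and arbitrary
    otherwise.\<close>
  have "\<exists>x0\<in>C. \<forall>x\<in>C - {x0}. degree (P x) \<ge> 1"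
  proof (cases "\<exists>x\<in>C. degree (P x) = 0")
    case True
    then show ?thesis using unique by (metis DiffD2 insertCI less_one linorder_not_less)
  next
    case False
    then show ?thesis using z12 by (fastforce simp: C_def)
  qed
  then obtain x0 where x0: "x0 \<in> C" "\<And>x. x \<in> C - {x0} \<Longrightarrow> degree (P x) \<ge> 1" by blast
  \<comment> \<open>Adding a multiple of \<open>r\<close> to \<open>q\<close> leaves the Wronskian
    unchanged. Taking \<open>P x0\<close> as the second factor cancels its degree from
    \<open>deg\<close>, so the other members have total degree less than \<open>degree a\<close>;
    each contributes at least 1.\<close>
  have "W = pderiv r * P x0 - r * pderiv (P x0)"
    by (simp add: W_def P_def pderiv_add pderiv_smult algebra_simps)
  then have "degree W < degree r + degree (P x0)"
    using degree_wronskian_less W_nz by metis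
  moreover have "(\<Sum>x\<in>C. degree (P x)) = degree (P x0) + (\<Sum>x\<in>C - {x0}. degree (P x))"
    using C x0 by (simp add: sum.remove)
  moreover have "card (C - {x0}) \<le> (\<Sum>x\<in>C - {x0}. degree (P x))"
    using sum_mono[of "C - {x0}" "\<lambda>_. 1::nat" "\<lambda>x. degree (P x)"] x0(2) by simp
  moreover have "card (C - {x0}) = card Z - 1" using C x0 by simp
  ultimately show ?thesis using deg by linarith
qed

lemma riccati_solutions_subset_card_le:
  fixes a b0 b1 b2 :: "'a::{field_char_0,field_gcd} poly"
  assumes "b2 \<noteq> 0" and Y: "Y \<subseteq> riccati_poly_solutions a b0 b1 b2" "finite Y"
  shows "card Y \<le> riccati_bound (riccati_degree a b0 b1 b2)"
\<comment> \<open>The pencil needs two nonzero solutions besides the one translated to 0. With fewer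
  than three solutions the claim holds because \<open>riccati_bound\<close> is never below
  2.\<close>
proof (cases "card Y \<ge> 3")
  case True
  then obtain y0 where y0: "y0 \<in> Y" by fastforce
  define Z where "Z = (\<lambda>y. y - y0) ` (Y - {y0})"
  have cZ: "card Z = card Y - 1"
    unfolding Z_def using y0 Y by (subst card_image) (auto simp: inj_on_def)
  have "card Z \<le> degree a"
  proof (rule bernoulli_solutions_card_le)
    show "finite Z" "0 \<notin> Z" using Y by (auto simp: Z_def)
    show "card Z \<ge> 2" using cZ True by simp
    show "b2 \<noteq> 0" by fact
  next
    fix z assume "z \<in> Z"
    then obtain y where y: "y \<in> Y" "z = y - y0" by (auto simp: Z_def)
    have "a * pderiv y = b0 + b1 * y + b2 * y^2" "a * pderiv y0 = b0 + b1 * y0 + b2 * y0^2"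
      using y(1) y0 Y by (auto simp: riccati_poly_solutions_def)
    then have "a * pderiv z = b0 + b1 * y + b2 * y^2 - (b0 + b1 * y0 + b2 * y0^2)"
      by (simp add: y pderiv_diff right_diff_distrib)
    \<comment> \<open>Translation by \<open>y0\<close> removes the constant term and adds
      \<open>2 * b2 * y0\<close> to the linear coefficient.\<close>
    then show "a * pderiv z = z * ((b1 + 2 * b2 * y0) + b2 * z)"
      by (simp add: y algebra_simps power2_eq_square)
  qed
  moreover have "degree a \<le> riccati_degree a b0 b1 b2" by (simp add: riccati_degree_def)
  ultimately show ?thesis using cZ True by (auto simp: riccati_bound_def)
qed (auto simp: riccati_bound_def)

text \<open>Finiteness comes from the bound being uniform over all finite subsets of the solution
  set.\<close>

lemma riccati_solutions_card_le:
  fixes a b0 b1 b2 :: "'a::{field_char_0,field_gcd} poly"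
  assumes "b2 \<noteq> 0"
  shows "finite (riccati_poly_solutions a b0 b1 b2) \<and>
    card (riccati_poly_solutions a b0 b1 b2) \<le> riccati_bound (riccati_degree a b0 b1 b2)"
  by (rule finite_if_finite_subsets_card_bdd) (use riccati_solutions_subset_card_le[OF assms] in blast)

section \<open>Equations with a prescribed number of solutions\<close>

lemma riccati_poly_solutions_mult:
  assumes "m \<noteq> 0"
  shows "riccati_poly_solutions (m * a) (m * b0) (m * b1) (m * b2) = riccati_poly_solutions a b0 b1 b2"
proof -
  have "m * a * pderiv y = m * b0 + m * b1 * y + m * b2 * y\<^sup>2 \<longleftrightarrow>
      m * (a * pderiv y) = m * (b0 + b1 * y + b2 * y\<^sup>2)" for y
    by (simp add: algebra_simps)
  then show ?thesis using assms by (simp add: riccati_poly_solutions_def)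
qed

text \<open>A nonconstant \<open>y\<close> is impossible, as its square has larger degree than its
  derivative. The values 0 and -1 of \<open>k\<close> give one and two solutions in degree 0; over
  the reals, 1 gives none.\<close>

lemma constant_solutions:
  fixes k :: "'a::field_char_0"
  shows "riccati_poly_solutions 1 [:k:] 0 1 = (\<lambda>c. [:c:]) ` {c. c^2 = - k}"
proof -
  have const: "degree y = 0" if "pderiv y = [:k:] + y^2" for y :: "'a poly"
  proof (rule ccontr)
    assume "degree y \<noteq> 0"
    then have "degree (y^2) = 2 * degree y" by (subst degree_power_eq) auto
    with \<open>degree y \<noteq> 0\<close> have "degree (y^2 + [:k:]) = 2 * degree y"
      by (subst degree_add_eq_left) auto
    then have "degree (pderiv y) = 2 * degree y" using that by (simp add: add.commute)
    then show False using \<open>degree y \<noteq> 0\<close> by (simp add: degree_pderiv)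
  qed
  have iff: "pderiv [:c:] = [:k:] + [:c:]^2 \<longleftrightarrow> c^2 = - k" for c
    by (auto simp: power2_eq_square eq_neg_iff_add_eq_0 add.commute)
  have "pderiv y = [:k:] + y^2 \<longleftrightarrow> y \<in> (\<lambda>c. [:c:]) ` {c. c^2 = - k}" for y
  proof
    assume y: "pderiv y = [:k:] + y^2"
    with const obtain c where "y = [:c:]" by (metis degree_eq_zeroE)
    with y iff show "y \<in> (\<lambda>c. [:c:]) ` {c. c^2 = - k}" by blast
  qed (use iff in blast)
  then show ?thesis by (simp add: riccati_poly_solutions_def)
qed

lemma ex_riccati_card_max:
  assumes "n \<ge> 1"
  shows "\<exists>a b0 b1 b2 :: 'a::{field_char_0,field_gcd} poly. a \<noteq> 0 \<and> b2 \<noteq> 0 \<and>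
    riccati_degree a b0 b1 b2 = n \<and> card (riccati_poly_solutions a b0 b1 b2) = n + 1"
proof -
  define L where "L = (\<lambda>i::nat. [:- of_nat i, 1:] :: 'a poly)"
  define h where "h = (\<Prod>i<n. L i)"
  define y where "y = (\<lambda>i. \<Prod>j\<in>{..<n} - {i}. L j)"
  have L_nz: "L i \<noteq> 0" for i by (simp add: L_def)
  have h: "h = L i * y i" if "i < n" for i using that by (simp add: h_def y_def prod.remove)
  have h_nz: "h \<noteq> 0" and y_nz: "y i \<noteq> 0" for i using L_nz by (auto simp: h_def y_def)
  have deg: "degree h = n" unfolding h_def by (subst degree_prod_sum_eq) (auto simp: L_def)
  define S where "S = riccati_poly_solutions h 0 (pderiv h) (- 1)"
  have rd: "riccati_degree h 0 (pderiv h) (- 1) = n"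
    using deg by (auto simp: riccati_degree_def degree_pderiv)
  have "y i \<in> S" if "i < n" for i
  proof -
    have "pderiv (L i) = 1" by (simp add: L_def pderiv_pCons)
    then show ?thesis unfolding S_def riccati_poly_solutions_def h[OF that]
      by (simp add: pderiv_mult algebra_simps power2_eq_square)
  qed
  moreover have "0 \<in> S" by (simp add: S_def riccati_poly_solutions_def)
  ultimately have sub: "insert 0 (y ` {..<n}) \<subseteq> S" by auto
  have "inj_on y {..<n}"
  proof
    fix i j assume ij: "i \<in> {..<n}" "j \<in> {..<n}" "y i = y j"
    then have "L i * y i = L j * y i" by (metis h lessThan_iff)
    then have "L i = L j" using y_nz[of i] by (metis mult_right_cancel)
    then show "i = j" by (simp add: L_def)
  qed
  then have "card (insert 0 (y ` {..<n})) = n + 1"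
    using y_nz by (subst card_insert_disjoint) (auto simp: card_image image_iff)
  \<comment> \<open>The upper bound excludes any solution beyond the \<open>n + 1\<close> exhibited
    ones.\<close>
  moreover have "finite S" "card S \<le> n + 1"
    using riccati_solutions_card_le[of "- 1" h 0 "pderiv h"] rd assms
    by (auto simp: S_def riccati_bound_def)
  ultimately have "card S = n + 1" using sub by (metis card_mono le_antisym)
  moreover have "(- 1 :: 'a poly) \<noteq> 0" by simp
  ultimately show ?thesis using h_nz rd unfolding S_def by blast
qed

lemma riccati_degree_mult:
  fixes m a b0 b1 b2 :: "'a::field poly"
  assumes "m \<noteq> 0" "a \<noteq> 0"
  shows "riccati_degree (m * a) (m * b0) (m * b1) (m * b2) = degree m + riccati_degree a b0 b1 b2"
proof -
  have le: "degree (m * b) \<le> degree m + degree b" for b by (rule degree_mult_le)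
  have a: "degree (m * a) = degree m + degree a" using assms by (rule degree_mult_eq)
  \<comment> \<open>A zero coefficient has degree 0 and gains nothing from the factor
    \<open>m\<close>; the nonzero \<open>a\<close> then supplies the missing degree.\<close>
  have ge: "degree m + degree b \<le> degree (m * a) \<or> degree m + degree b \<le> degree (m * b)" for b
    using assms a by (cases "b = 0") (auto simp: degree_mult_eq)
  define D where "D = riccati_degree a b0 b1 b2"
  define E where "E = riccati_degree (m * a) (m * b0) (m * b1) (m * b2)"
  have D: "degree a \<le> D" "degree b0 \<le> D" "degree b1 \<le> D" "degree b2 \<le> D"
    by (simp_all add: D_def riccati_degree_def)
  have E: "degree (m * a) \<le> E" "degree (m * b0) \<le> E" "degree (m * b1) \<le> E" "degree (m * b2) \<le> E"
    by (simp_all add: E_def riccati_degree_def)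
  have "D \<in> {degree a, degree b0, degree b1, degree b2}"
    unfolding D_def riccati_degree_def by (rule Max_in) auto
  then have "degree m + D \<le> E"
    using ge[of a] ge[of b0] ge[of b1] ge[of b2] E by (elim insertE emptyE) linarith+
  moreover have "E \<in> {degree (m * a), degree (m * b0), degree (m * b1), degree (m * b2)}"
    unfolding E_def riccati_degree_def by (rule Max_in) auto
  then have "E \<le> degree m + D"
    using le[of a] le[of b0] le[of b1] le[of b2] D by (elim insertE emptyE) linarith+
  ultimately show ?thesis by (simp add: D_def E_def)
qed

text \<open>The excluded pair is the only one whose answer depends on the field. For positive
  \<open>N\<close>, an example of possibly smaller degree is multiplied by a power of x, which
  raises the degree and keeps the solutions.\<close>

lemma ex_riccati_card:
  assumes "N \<le> riccati_bound \<eta>" "\<not> (\<eta> = 0 \<and> N = 0)"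
  shows "\<exists>a b0 b1 b2 :: 'a::{field_char_0,field_gcd} poly. a \<noteq> 0 \<and> b2 \<noteq> 0 \<and>
    riccati_degree a b0 b1 b2 = \<eta> \<and> card (riccati_poly_solutions a b0 b1 b2) = N"
proof (cases "N = 0")
  case True
  then have "\<eta> > 0" using assms(2) by auto
  let ?m = "monom (1::'a) \<eta>"
  \<comment> \<open>At x = 0 this equation would read 0 = 1.\<close>
  have "?m * pderiv y \<noteq> 1 + 0 * y + ?m * y^2" for y
  proof
    assume "?m * pderiv y = 1 + 0 * y + ?m * y^2"
    then have "poly (?m * pderiv y) 0 = poly (1 + 0 * y + ?m * y^2) 0" by simp
    then show False using \<open>\<eta> > 0\<close> by (simp add: poly_monom zero_power)
  qed
  then have "riccati_poly_solutions ?m 1 0 ?m = {}"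
    unfolding riccati_poly_solutions_def by blast
  moreover have "riccati_degree ?m 1 0 ?m = \<eta>" by (simp add: riccati_degree_def degree_monom_eq)
  ultimately show ?thesis using True
    by (intro exI[of _ ?m] exI[of _ 1] exI[of _ 0]) auto
next
  case False
  \<comment> \<open>In positive degree \<open>d\<close> the maximal example has \<open>d + 1\<close>
    solutions. The exception covers the two solutions allowed in degree 0.\<close>
  define d where "d = (if N = 2 \<and> \<eta> = 0 then 0 else N - 1)"
  have "d \<le> \<eta>" using assms False by (auto simp: d_def riccati_bound_def split: if_splits)
  have "\<exists>a b0 b1 b2 :: 'a poly. a \<noteq> 0 \<and> b2 \<noteq> 0 \<and>
    riccati_degree a b0 b1 b2 = d \<and> card (riccati_poly_solutions a b0 b1 b2) = N"
  proof (cases "d = 0")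
    case True
    then have "N = 1 \<or> N = 2" using False by (auto simp: d_def split: if_splits)
    moreover have "card (riccati_poly_solutions 1 [:0::'a:] 0 1) = 1"
      unfolding constant_solutions by simp
    moreover have "card (riccati_poly_solutions 1 [:-1::'a:] 0 1) = 2"
      unfolding constant_solutions by (simp add: power2_eq_1_iff Collect_disj_eq)
    ultimately obtain k :: 'a where "card (riccati_poly_solutions 1 [:k:] 0 1) = N" by blast
    then show ?thesis using True
      by (intro exI[of _ 1] exI[of _ "[:k:]"] exI[of _ 0]) (simp add: riccati_degree_def)
  next
    case d: False
    then have "N = d + 1" by (auto simp: d_def split: if_splits)
    then show ?thesis using ex_riccati_card_max[of d] d by auto
  qed
  then obtain a b0 b1 b2 :: "'a poly" where R: "a \<noteq> 0" "b2 \<noteq> 0"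
    "riccati_degree a b0 b1 b2 = d" "card (riccati_poly_solutions a b0 b1 b2) = N" by blast
  define m where "m = monom (1::'a) (\<eta> - d)"
  have m: "m \<noteq> 0" "degree m = \<eta> - d" by (auto simp: m_def degree_monom_eq)
  have "riccati_degree (m * a) (m * b0) (m * b1) (m * b2) = \<eta>"
    using riccati_degree_mult[OF m(1) R(1)] R m \<open>d \<le> \<eta>\<close> by simp
  moreover have "card (riccati_poly_solutions (m * a) (m * b0) (m * b1) (m * b2)) = N"
    using R(4) by (simp add: riccati_poly_solutions_mult[OF m(1)])
  moreover have "m * a \<noteq> 0" "m * b2 \<noteq> 0" using R m by auto
  ultimately show ?thesis by blast
qed

lemma real_riccati_no_solution: "riccati_poly_solutions 1 [:1::real:] 0 1 = {}"
proof -
  have "c^2 \<noteq> -1" for c :: real using zero_le_power2[of c] by linarith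
  then show ?thesis unfolding constant_solutions by simp
qed

text \<open>Finiteness is asserted separately because \<open>card\<close> of an infinite set is 0.
  In the existence claims \<open>a\<close> is nonzero, so that the examples are genuine differential
  equations. The complex claim omits \<eta> = 0 with \<open>N\<close> = 0, in accordance with
  \<open>complex_riccati_degree_0_solvable\<close>.\<close>

theorem theorem1:
  "(\<forall>a b0 b1 b2 :: real poly. b2 \<noteq> 0 \<longrightarrow>
      finite (riccati_poly_solutions a b0 b1 b2) \<and>
      card (riccati_poly_solutions a b0 b1 b2) \<le> riccati_bound (riccati_degree a b0 b1 b2)) \<and>
   (\<forall>a b0 b1 b2 :: complex poly. b2 \<noteq> 0 \<longrightarrow>
      finite (riccati_poly_solutions a b0 b1 b2) \<and>
      card (riccati_poly_solutions a b0 b1 b2) \<le> riccati_bound (riccati_degree a b0 b1 b2)) \<and>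
   (\<forall>\<eta> N :: nat. N \<le> riccati_bound \<eta> \<longrightarrow>
      (\<exists>a b0 b1 b2 :: real poly. a \<noteq> 0 \<and> b2 \<noteq> 0 \<and> riccati_degree a b0 b1 b2 = \<eta> \<and>
         finite (riccati_poly_solutions a b0 b1 b2) \<and>
         card (riccati_poly_solutions a b0 b1 b2) = N)) \<and>
   (\<forall>\<eta> N :: nat. N \<le> riccati_bound \<eta> \<longrightarrow> \<not> (\<eta> = 0 \<and> N = 0) \<longrightarrow>
      (\<exists>a b0 b1 b2 :: complex poly. a \<noteq> 0 \<and> b2 \<noteq> 0 \<and> riccati_degree a b0 b1 b2 = \<eta> \<and>
         finite (riccati_poly_solutions a b0 b1 b2) \<and>
         card (riccati_poly_solutions a b0 b1 b2) = N))"
proof (intro conjI allI impI)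
  fix \<eta> N :: nat assume N: "N \<le> riccati_bound \<eta>"
  have "\<exists>a b0 b1 b2 :: real poly. a \<noteq> 0 \<and> b2 \<noteq> 0 \<and> riccati_degree a b0 b1 b2 = \<eta> \<and>
      card (riccati_poly_solutions a b0 b1 b2) = N"
  proof (cases "\<eta> = 0 \<and> N = 0")
    case True
    then show ?thesis using real_riccati_no_solution
      by (intro exI[of _ 1] exI[of _ "[:1:]"] exI[of _ 0]) (auto simp: riccati_degree_def)
  qed (use ex_riccati_card[OF N] in blast)
  then show "\<exists>a b0 b1 b2 :: real poly. a \<noteq> 0 \<and> b2 \<noteq> 0 \<and> riccati_degree a b0 b1 b2 = \<eta> \<and>
      finite (riccati_poly_solutions a b0 b1 b2) \<and> card (riccati_poly_solutions a b0 b1 b2) = N"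
    using riccati_solutions_card_le by metis
next
  fix \<eta> N :: nat assume "N \<le> riccati_bound \<eta>" "\<not> (\<eta> = 0 \<and> N = 0)"
  then show "\<exists>a b0 b1 b2 :: complex poly. a \<noteq> 0 \<and> b2 \<noteq> 0 \<and> riccati_degree a b0 b1 b2 = \<eta> \<and>
      finite (riccati_poly_solutions a b0 b1 b2) \<and> card (riccati_poly_solutions a b0 b1 b2) = N"
    using ex_riccati_card riccati_solutions_card_le by metis
qed (simp_all add: riccati_solutions_card_le)

end
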